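(* For $K\in\mathbb{N}$ let $$P(K)=\Big(\tfrac1K\mathbb{Z}^2+\tfrac1{2K}\tbinom{1}{1}\Big)\cap I^2$$ and let $N=\#P(K)$ (so $N=K^2$). Then $$\frac12\ \leq\ \sqrt{N}\cdot\mathcal{D}\big(L(P(K))\big)\ \leq\ \sqrt{18}.$$
   Context: $\mathbb{S}^2\subset\mathbb{R}^3$ is the unit sphere, $\sigma$ its normalized surface measure. For $w\in\mathbb{S}^2$ and $t\in[-1,1]$, $C(w,t)=\{x\in\mathbb{S}^2 : \langle w,x\rangle\geq t\}$. For a finite set $P_N=\{p_1,\dots,p_N\}\subset\mathbb{S}^2$ of $N$ points, the spherical cap discrepancy is $$\mathcal{D}(P_N)=\sup_{w\in\mathbb{S}^2}\sup_{-1\leq t\leq 1}\Big|\frac1N\sum_{j=1}^N\chi_{C(w,t)}(p_j)-\sigma(C(w,t))\Big|.$$ $I^2=[0,1)\times(0,1)$, and $\mathbb{S}^2_p$ is $\mathbb{S}^2$ with the poles $(0,0,\pm1)$ removed. The Lambert map is the (area preserving) bijection $L:I^2\to\mathbb{S}^2_p$, $$L(x,y)=\big(2\sqrt{y-y^2}\cos(2\pi x),\,2\sqrt{y-y^2}\sin(2\pi x),\,1-2y\big).$$ *)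

theory Defs
  imports "HOL-Probability.Probability"
begin

(* The normalized surface measure on the unit sphere, via polar coordinates: the surface
   measure of A is the share of the unit ball taken up by the cone {r *\<^sub>R a | 0 < r \<le> 1, a \<in> A}.
   Note that sgn x is x /\<^sub>R norm x; the origin, where sgn is 0, is a null set. *)
definition sphere_measure :: "(real^3) measure" where
  "sphere_measure =
     restrict_space (distr (uniform_measure lborel (cball 0 1)) borel sgn) (sphere 0 1)"

definition spherical_cap :: "real^3 \<Rightarrow> real \<Rightarrow> (real^3) set" where
  "spherical_cap w t = {x \<in> sphere 0 1. w \<bullet> x \<ge> t}"

definition cap_discrepancy :: "(real^3) set \<Rightarrow> real" where
  "cap_discrepancy P =
     (SUP w \<in> sphere 0 1. SUP t \<in> {-1..1}.
        \<bar>(\<Sum>p\<in>P. indicator (spherical_cap w t) p) / real (card P)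
          - measure sphere_measure (spherical_cap w t)\<bar>)"

definition lambert :: "real \<times> real \<Rightarrow> real^3" where
  "lambert = (\<lambda>(x, y). vector [2 * sqrt (y - y\<^sup>2) * cos (2 * pi * x),
                               2 * sqrt (y - y\<^sup>2) * sin (2 * pi * x),
                               1 - 2 * y])"

definition shifted_grid :: "nat \<Rightarrow> (real \<times> real) set" where
  "shifted_grid K =
     {(of_int m / real K + 1 / (2 * real K), of_int n / real K + 1 / (2 * real K)) | m n :: int. True}
     \<inter> ({0..<1} \<times> {0<..<1})"

lemma sets_sphere_measure: "sets sphere_measure = sets (restrict_space borel (sphere 0 1))"
  by (simp add: sphere_measure_def sets_restrict_space)

lemma space_sphere_measure: "space sphere_measure = sphere 0 1"
  by (simp add: sphere_measure_def space_restrict_space)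

lemma spherical_cap_in_sets: "spherical_cap w t \<in> sets sphere_measure"
proof -
  have "closed {x. w \<bullet> x \<ge> t}"
    by (intro closed_Collect_le continuous_intros)
  then have "{x. w \<bullet> x \<ge> t} \<in> sets borel" by simp
  moreover have "spherical_cap w t = sphere 0 1 \<inter> {x. w \<bullet> x \<ge> t}"
    by (auto simp: spherical_cap_def)
  ultimately show ?thesis
    by (auto simp: sets_sphere_measure sets_restrict_space)
qed

lemma emeasure_sphere_measure:
  assumes "A \<in> sets borel" "A \<subseteq> sphere 0 1"
  shows "emeasure sphere_measure A =
    emeasure lborel {x \<in> cball 0 1. sgn x \<in> A} / emeasure lborel (cball 0 1 :: (real^3) set)"
proof -
  have [measurable]: "(sgn :: real^3 \<Rightarrow> _) \<in> borel_measurable borel"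
    unfolding sgn_div_norm by measurable
  have [measurable]: "A \<in> sets borel" by fact
  have 1: "sgn -` A \<in> sets borel"
    using measurable_sets[of "sgn :: real^3 \<Rightarrow> _" borel borel A] assms by simp
  have "emeasure sphere_measure A = emeasure (distr (uniform_measure lborel (cball 0 1)) borel sgn) A"
    unfolding sphere_measure_def using assms by (subst emeasure_restrict_space) auto
  also have "\<dots> = emeasure (uniform_measure lborel (cball 0 1)) (sgn -` A)"
    by (subst emeasure_distr) auto
  also have "\<dots> = emeasure lborel (cball 0 1 \<inter> sgn -` A) / emeasure lborel (cball 0 1 :: (real^3) set)"
    using 1 by (subst emeasure_uniform_measure) auto
  also have "cball 0 1 \<inter> sgn -` A = {x \<in> cball 0 1. sgn x \<in> A}" by auto
  finally show ?thesis .
qed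

lemma prob_space_sphere_measure: "prob_space sphere_measure"
proof
  let ?B = "cball 0 1 :: (real^3) set"
  have cone: "{x \<in> ?B. sgn x \<in> sphere 0 1} = ?B - {0}" by (auto simp: norm_sgn)
  have "emeasure lborel (?B - {0}) = emeasure lborel ?B"
    by (rule emeasure_Diff_null_set) auto
  moreover have "emeasure sphere_measure (sphere 0 1) = emeasure lborel (?B - {0}) / emeasure lborel ?B"
    unfolding cone[symmetric] by (rule emeasure_sphere_measure) auto
  moreover have "unit_ball_vol (3::real) \<noteq> 0"
    by (rule less_imp_neq[THEN not_sym]) (rule unit_ball_vol_pos, simp)
  then have "emeasure lborel ?B \<noteq> 0"
    by (simp add: emeasure_cball)
  moreover have "emeasure lborel ?B \<noteq> \<infinity>"
    using emeasure_lborel_cball_finite[of "0::real^3" 1] by (rule less_imp_neq)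
  ultimately show "emeasure sphere_measure (space sphere_measure) = 1"
    by (metis space_sphere_measure ennreal_divide_self less_top infinity_ennreal_def)
qed

(* Together with prob_space_sphere_measure, rotation invariance characterizes the measure. *)
lemma measure_sphere_measure_orthogonal:
  assumes f: "orthogonal_transformation f" and A: "A \<in> sets borel" "A \<subseteq> sphere 0 1"
  shows "measure sphere_measure (f -` A) = measure sphere_measure A"
proof -
  let ?C = "\<lambda>A. {x \<in> cball 0 1 :: (real^3) set. sgn x \<in> A}"
  have nf: "norm (f x) = norm x" for x
    using f by (rule orthogonal_transformation_norm)
  have lin: "linear f" using f by (rule orthogonal_transformation_linear)
  have sgn_f: "sgn (f x) = f (sgn x)" for x
    using lin by (simp add: sgn_div_norm nf linear_scale)
  have contf: "continuous_on UNIV f"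
    using lin by (simp add: linear_continuous_on linear_conv_bounded_linear)
  have [measurable]: "f \<in> borel_measurable borel"
    using contf by (rule borel_measurable_continuous_onI)
  have fA: "f -` A \<in> sets borel" "f -` A \<subseteq> sphere 0 1"
    using measurable_sets[of f borel borel A] A nf by auto
  have Cb: "?C B \<in> sets borel" if "B \<in> sets borel" for B
  proof -
    have "?C B = cball 0 1 \<inter> sgn -` B" by auto
    moreover have "sgn -` B \<in> sets borel"
      using measurable_sets[OF borel_measurable_sgn, of B] that by simp
    ultimately show ?thesis by auto
  qed
  have "?C (f -` A) \<in> lmeasurable"
    by (rule bounded_set_imp_lmeasurable)
       (use Cb[OF fA(1)] in \<open>auto intro!: bounded_subset[OF bounded_cball[of 0 1]]\<close>)
  then have "measure lebesgue (f ` ?C (f -` A)) = measure lebesgue (?C (f -` A))"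
    by (rule measure_orthogonal_image[OF f])
  moreover have "f ` ?C (f -` A) = ?C A"
  proof
    show "f ` ?C (f -` A) \<subseteq> ?C A" by (auto simp: nf sgn_f)
    show "?C A \<subseteq> f ` ?C (f -` A)"
    proof
      fix y assume y: "y \<in> ?C A"
      obtain x where "y = f x"
        using orthogonal_transformation_surj[OF f] by (metis surjD)
      with y show "y \<in> f ` ?C (f -` A)" by (auto simp: nf sgn_f)
    qed
  qed
  ultimately have "measure lborel (?C (f -` A)) = measure lborel (?C A)"
    using Cb[OF fA(1)] Cb[OF A(1)] by (simp add: measure_completion)
  moreover have "emeasure lborel (?C B) = ennreal (measure lborel (?C B))" if "B \<in> sets borel" for B
  proof -
    have "emeasure lborel (?C B) \<le> emeasure lborel (cball 0 1 :: (real^3) set)"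
      by (rule emeasure_mono) auto
    also have "\<dots> < \<infinity>" by (rule emeasure_lborel_cball_finite)
    finally have "emeasure lborel (?C B) \<noteq> \<top>"
      by (simp only: infinity_ennreal_def less_top)
    then show ?thesis by (rule emeasure_eq_ennreal_measure)
  qed
  ultimately have "emeasure lborel (?C (f -` A)) = emeasure lborel (?C A)"
    using fA(1) A(1) by presburger
  then show ?thesis
    by (simp only: measure_def emeasure_sphere_measure[OF A] emeasure_sphere_measure[OF fA])
qed

end

(* Write n(p) for the number of the K rotates of p about the z-axis (by multiples of 2 pi / K) that
   lie in a cap C, and cut the sphere into K zones of equal area. By rotation invariance, K^2 times
   the measure of C within a zone is the average of n over that zone, whereas n at the grid row of
   the zone is the number of grid points of C there. Along a parallel, n counts the points of a
   shifted lattice in a fixed arc, so it varies by at most 1. Along the meridians through a grid row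
   it varies, within the zone, at most by the number of these K meridians that change between inside
   and outside C in the zone; as a meridian meets C in an arc or in the complement of an arc, it does
   so in at most 2 zones. Altogether the count deviates by at most K + 2 K = 3 K < sqrt 18 K.
   The lower bound is attained by the polar cap whose boundary carries the first grid row. *)
theory Submission
  imports Defs
begin

section \<open>The Lambert map and the measure of zones\<close>

lemma lambert_nth [simp]:
  "lambert (x, y) $ 1 = 2 * sqrt (y - y\<^sup>2) * cos (2 * pi * x)"
  "lambert (x, y) $ 2 = 2 * sqrt (y - y\<^sup>2) * sin (2 * pi * x)"
  "lambert (x, y) $ 3 = 1 - 2 * y"
  by (simp_all add: lambert_def)

lemma inner_vec3: "(v :: real^3) \<bullet> w = v$1 * w$1 + v$2 * w$2 + v$3 * w$3"
  by (simp add: inner_vec_def sum_3)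

lemma inner_axis_3: "axis 3 1 \<bullet> p = p $ 3" for p :: "real^3"
  by (simp add: inner_axis')

lemma diff_square_nonneg: "0 \<le> y - y\<^sup>2" if "0 \<le> y" "y \<le> (1::real)"
  using mult_nonneg_nonneg[of y "1 - y"] that by (simp add: power2_eq_square algebra_simps)

lemma diff_square_pos: "0 < y - y\<^sup>2" if "0 < y" "y < (1::real)"
  using mult_pos_pos[of y "1 - y"] that by (simp add: power2_eq_square algebra_simps)

lemma norm_lambert: "norm (lambert (x, y)) = 1" if "0 \<le> y" "y \<le> 1"
proof -
  define c where "c = cos (2*pi*x)"
  define s where "s = sin (2*pi*x)"
  have "lambert (x, y) \<bullet> lambert (x, y) = 4 * (y - y\<^sup>2) * (c\<^sup>2 + s\<^sup>2) + (1 - 2*y)\<^sup>2"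
    using diff_square_nonneg[OF that]
    unfolding inner_vec3 lambert_nth c_def[symmetric] s_def[symmetric]
    by (simp add: power_mult_distrib algebra_simps flip: power2_eq_square)
  also have "\<dots> = 1"
    by (simp add: c_def s_def) (simp add: power2_eq_square algebra_simps)
  finally show ?thesis by (simp add: norm_eq_1)
qed

text \<open>The third coordinate determines \<open>y\<close>. Off the poles the parallel has nonzero
  radius, so the first two coordinates determine sine and cosine of \<open>2 * pi * x\<close>, hence
  \<open>x\<close> modulo 1.\<close>

lemma lambert_eq_iff:
  assumes "0 < y" "y < 1" "0 \<le> x" "x < 1" "0 \<le> x'" "x' < 1"
  shows "lambert (x, y) = lambert (x', y') \<longleftrightarrow> x = x' \<and> y = y'"
proof
  assume eq: "lambert (x, y) = lambert (x', y')"
  have y: "y = y'"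
    using arg_cong[OF eq, of "\<lambda>v. v $ 3"] by simp
  have "sqrt (y - y\<^sup>2) \<noteq> 0"
    using diff_square_pos[of y] assms by simp
  then have "sin (2*pi*x) = sin (2*pi*x') \<and> cos (2*pi*x) = cos (2*pi*x')"
    using arg_cong[OF eq, of "\<lambda>v. v $ 1"] arg_cong[OF eq, of "\<lambda>v. v $ 2"] y by simp
  then obtain n :: int where "2*pi*x = 2*pi*x' + 2*pi*n"
    unfolding sin_cos_eq_iff by blast
  then have "2*pi*x = 2*pi*(x' + n)" by (simp add: algebra_simps)
  then have n: "x = x' + n" by simp
  then have "n = 0" using assms by linarith
  with n y show "x = x' \<and> y = y'" by simp
qed auto

text \<open>The cube root makes the Jacobian determinant of this map from the unit cube to the unit
  ball constant.\<close>
definition lambert_ball :: "real^3 \<Rightarrow> real^3" where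
  "lambert_ball u = (u $ 1 powr (1/3)) *\<^sub>R lambert (u $ 2, u $ 3)"

text \<open>Here \<open>r'\<close> is the derivative of the cube root \<open>r\<close>, and
  \<open>2 * z / q\<close> that of the radius \<open>q\<close> of the parallel.\<close>

definition lambert_ball_deriv :: "real^3 \<Rightarrow> real^3 \<Rightarrow> real^3" where
  "lambert_ball_deriv u h =
    (let r = u $ 1 powr (1/3); r' = 1/3 * u $ 1 powr (- 2/3);
         q = 2 * sqrt (u $ 3 - (u $ 3)\<^sup>2); z = 1 - 2 * u $ 3;
         c = cos (2 * pi * u $ 2); s = sin (2 * pi * u $ 2)
     in vector [r' * q * c * h $ 1 - 2 * pi * r * q * s * h $ 2 + r * (2 * z / q) * c * h $ 3,
                r' * q * s * h $ 1 + 2 * pi * r * q * c * h $ 2 + r * (2 * z / q) * s * h $ 3,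
                r' * z * h $ 1 - 2 * r * h $ 3])"

lemma has_derivative_vec3:
  fixes f :: "'a::euclidean_space \<Rightarrow> real^3"
  assumes "\<And>i. ((\<lambda>x. f x $ i) has_derivative (\<lambda>h. f' h $ i)) (at a)"
  shows "(f has_derivative f') (at a)"
  using has_derivative_componentwise_within[of f f' a UNIV] assms
  by (auto simp: Basis_vec_def inner_axis)

lemma has_derivative_lambert_ball:
  assumes "0 < u $ 1" "0 < u $ 3" "u $ 3 < 1"
  shows "(lambert_ball has_derivative lambert_ball_deriv u) (at u)"
proof -
  have pos: "0 < u $ 3 - (u $ 3)\<^sup>2" using assms diff_square_pos by blast
  have nth: "((\<lambda>v. v $ i) has_derivative (\<lambda>h. h $ i)) (at u)" for i
    by (intro bounded_linear_imp_has_derivative bounded_linear_vec_nth)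
  define r' where "r' = 1/3 * u $ 1 powr (- 2/3)"
  define q where "q = 2 * sqrt (u $ 3 - (u $ 3)\<^sup>2)"
  define q' where "q' = 2 * (1 - 2 * u $ 3) / q"
  \<comment> \<open>The left side is the form in which the rule for \<open>powr\<close> delivers the
    derivative.\<close>
  have r': "u $ 1 powr (1/3) / (3 * u $ 1) = r'"
    using assms powr_diff[of "u $ 1" "1/3" 1] by (simp add: r'_def)
  have dr: "((\<lambda>v. v $ 1 powr (1/3)) has_derivative (\<lambda>h. h $ 1 * r')) (at u)"
    by (rule derivative_eq_intros nth refl assms)+
       (use assms in \<open>simp_all add: fun_eq_iff flip: r'\<close>)
  have dq: "((\<lambda>v. 2 * sqrt (v $ 3 - (v $ 3)\<^sup>2)) has_derivative (\<lambda>h. h $ 3 * q')) (at u)"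
    by (rule derivative_eq_intros nth refl pos)+
       (use pos in \<open>auto simp: fun_eq_iff q'_def q_def field_simps\<close>)
  show ?thesis
  proof (rule has_derivative_vec3)
    fix i :: 3
    consider "i = 1" | "i = 2" | "i = 3" using exhaust_3 by blast
    then show "((\<lambda>v. lambert_ball v $ i) has_derivative (\<lambda>h. lambert_ball_deriv u h $ i)) (at u)"
    proof cases
      case 1
      show ?thesis
        unfolding 1 lambert_ball_def vector_scaleR_component lambert_nth
        by (rule dr dq nth refl derivative_eq_intros)+
           (simp add: lambert_ball_deriv_def Let_def fun_eq_iff algebra_simps
             r'_def q'_def diff_divide_distrib add_divide_distrib flip: q_def)
    next
      case 2
      show ?thesis
        unfolding 2 lambert_ball_def vector_scaleR_component lambert_nth
        by (rule dr dq nth refl derivative_eq_intros)+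
           (simp add: lambert_ball_deriv_def Let_def fun_eq_iff algebra_simps
             r'_def q'_def diff_divide_distrib add_divide_distrib flip: q_def)
    next
      case 3
      show ?thesis
        unfolding 3 lambert_ball_def vector_scaleR_component lambert_nth
        by (rule dr dq nth refl derivative_eq_intros)+
           (simp add: lambert_ball_deriv_def Let_def fun_eq_iff r'_def)
    qed
  qed
qed

text \<open>The radial factors combine to \<open>r' * r\<^sup>2 = 1/3\<close>, and the rest
  collapses because \<open>(q, z)\<close> and \<open>(c, s)\<close> lie on the unit circle. The
  absolute value is the volume of the unit ball; the sign says that orientation is reversed.\<close>

lemma det_lambert_ball_deriv:
  assumes "0 < u $ 1" "0 < u $ 3" "u $ 3 < 1"
  shows "det (matrix (lambert_ball_deriv u)) = - (4 / 3 * pi)"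
proof -
  have pos: "0 < u $ 3 - (u $ 3)\<^sup>2" using assms diff_square_pos by blast
  define r where "r = u $ 1 powr (1/3)"
  define r' where "r' = 1/3 * u $ 1 powr (- 2/3)"
  define q where "q = 2 * sqrt (u $ 3 - (u $ 3)\<^sup>2)"
  define z where "z = 1 - 2 * u $ 3"
  define c where "c = cos (2 * pi * u $ 2)"
  define s where "s = sin (2 * pi * u $ 2)"
  have cs: "c\<^sup>2 + s\<^sup>2 = 1" by (simp add: c_def s_def)
  have q: "q > 0" using pos by (simp add: q_def)
  have qz: "q\<^sup>2 + z\<^sup>2 = 1"
    using pos by (simp add: q_def z_def power_mult_distrib) (simp add: power2_eq_square algebra_simps)
  have r: "r' * r\<^sup>2 = 1/3"
  proof -
    have "r\<^sup>2 = u $ 1 powr (2/3)"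
      by (simp add: r_def power2_eq_square flip: powr_add)
    then show ?thesis using assms by (simp add: r'_def flip: powr_add)
  qed
  define M where "M = matrix (lambert_ball_deriv u)"
  have M: "M$1$1 = r' * q * c" "M$1$2 = - 2 * pi * r * q * s" "M$1$3 = r * (2 * z / q) * c"
     "M$2$1 = r' * q * s" "M$2$2 = 2 * pi * r * q * c" "M$2$3 = r * (2 * z / q) * s"
     "M$3$1 = r' * z" "M$3$2 = 0" "M$3$3 = - 2 * r"
    by (simp_all add: M_def matrix_def lambert_ball_deriv_def Let_def axis_def
      r_def r'_def q_def z_def c_def s_def)
  have "det M = - 4 * pi * (r' * r\<^sup>2) * (c\<^sup>2 + s\<^sup>2) * (q\<^sup>2 + z\<^sup>2)"
    using q unfolding det_3 M by (simp add: field_simps power2_eq_square)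
  then show ?thesis by (simp add: M_def r cs qz)
qed

text \<open>By the constant Jacobian, change of variables multiplies the volume \<open>b - a\<close>
  of the box by \<open>4 / 3 * pi\<close>. The open box keeps away from the origin and the poles,
  where the derivative breaks down, and from the seam where longitudes 0 and 1 coincide.\<close>

lemma lambert_ball_image_box:
  assumes "0 \<le> a" "a \<le> b" "b \<le> 1"
  defines "S \<equiv> box (vector [0, 0, a]) (vector [1, 1, b]) :: (real^3) set"
  shows "lambert_ball ` S \<in> lmeasurable"
    and "measure lebesgue (lambert_ball ` S) = 4 / 3 * pi * (b - a)"
proof -
  have S: "u \<in> S \<longleftrightarrow> 0 < u$1 \<and> u$1 < 1 \<and> 0 < u$2 \<and> u$2 < 1 \<and> a < u$3 \<and> u$3 < b" for u
    by (auto simp: S_def mem_box_cart forall_3)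
  have inj: "inj_on lambert_ball S"
  proof (rule inj_onI)
    fix u v assume u: "u \<in> S" and v: "v \<in> S" and eq: "lambert_ball u = lambert_ball v"
    \<comment> \<open>The norm of the image recovers \<open>u $ 1\<close>; the direction then
      recovers the other two coordinates.\<close>
    have n: "norm (lambert_ball w) = w $ 1 powr (1/3)" if "w \<in> S" for w
      using that assms(1-3) norm_lambert[of "w$3" "w$2"] by (simp add: lambert_ball_def S)
    then have p: "u $ 1 powr (1/3) = v $ 1 powr (1/3)" using n[OF u] n[OF v] eq by simp
    have "(u $ 1 powr (1/3)) powr 3 = (v $ 1 powr (1/3)) powr 3" by (simp only: p)
    then have 1: "u $ 1 = v $ 1" using u v by (simp add: powr_powr S)
    then have "lambert (u$2, u$3) = lambert (v$2, v$3)"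
      using eq u v by (simp add: lambert_ball_def S)
    then have "u$2 = v$2 \<and> u$3 = v$3"
      using u v assms(1-3) lambert_eq_iff[of "u$3" "u$2" "v$2" "v$3"] by (simp add: S)
    with 1 show "u = v" by (simp add: vec_eq_iff forall_3)
  qed
  have der: "(lambert_ball has_derivative lambert_ball_deriv u) (at u within S)" if "u \<in> S" for u
    using that assms(1-3)
    by (intro has_derivative_at_withinI[OF has_derivative_lambert_ball]) (auto simp: S)
  have Basis: "(Basis :: (real^3) set) = {axis 1 1, axis 2 1, axis 3 1}"
    by (auto simp: Basis_vec_def UNIV_3)
  have "measure lborel S = b - a"
    using assms(1-3) unfolding S_def
    by (subst measure_lborel_box_eq) (auto simp: Basis inner_axis axis_eq_axis)
  moreover have "((\<lambda>u. 1 :: real) has_integral measure lborel S) S"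
    by (rule has_integral_measure_lborel) (use emeasure_lborel_box_finite in \<open>auto simp: S_def\<close>)
  ultimately have "((\<lambda>u. 1 :: real) has_integral (b - a)) S" by simp
  then have "((\<lambda>u. 4 / 3 * pi * 1) has_integral (4 / 3 * pi * (b - a))) S"
    by (rule has_integral_mult_right)
  moreover have "\<bar>det (matrix (lambert_ball_deriv u))\<bar> = 4 / 3 * pi * 1" if "u \<in> S" for u
    using that assms(1-3) det_lambert_ball_deriv[of u] by (simp add: S)
  ultimately have "((\<lambda>u. \<bar>det (matrix (lambert_ball_deriv u))\<bar>) has_integral (4 / 3 * pi * (b - a))) S"
    using has_integral_cong[of S "\<lambda>u. \<bar>det (matrix (lambert_ball_deriv u))\<bar>" "\<lambda>u. 4 / 3 * pi * 1"] by blast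
  then have "lambert_ball ` S \<in> lmeasurable \<and> measure lebesgue (lambert_ball ` S) = 4 / 3 * pi * (b - a)"
    by (rule has_measure_differentiable_image[THEN iffD2, OF _ der inj, rotated -1])
       (simp_all add: S_def)
  then show "lambert_ball ` S \<in> lmeasurable" "measure lebesgue (lambert_ball ` S) = 4 / 3 * pi * (b - a)"
    by auto
qed

text \<open>Only this lower bound is proved by change of variables: applied to a polar cap and to its
  complement, the two bounds add up to 1, hence both are equalities.\<close>
lemma sphere_measure_ge:
  assumes ab: "0 \<le> a" "a \<le> b" "b \<le> 1"
    and B: "B \<in> sets borel" "B \<subseteq> sphere 0 1"
    and sub: "\<And>x y. a < y \<Longrightarrow> y < b \<Longrightarrow> lambert (x, y) \<in> B"
  shows "b - a \<le> measure sphere_measure B"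
proof -
  define C where "C = {x \<in> cball 0 1. sgn x \<in> B}"
  define T where "T = lambert_ball ` box (vector [0, 0, a]) (vector [1, 1, b])"
  have "C = cball 0 1 \<inter> sgn -` B" by (auto simp: C_def)
  then have C: "C \<in> sets borel"
    using measurable_sets[OF borel_measurable_sgn, of B] B by auto
  \<comment> \<open>\<open>C\<close> is the cone over \<open>B\<close>, whose share of the ball is
    the measure of \<open>B\<close>; it contains the image \<open>T\<close> of the box, whose volume
    is known.\<close>
  have TC: "T \<subseteq> C"
  proof
    fix p assume "p \<in> T"
    then obtain u where p: "p = lambert_ball u" and
      u: "0 < u$1" "u$1 < 1" "a < u$3" "u$3 < b"
      by (auto simp: T_def mem_box_cart forall_3)
    have n: "norm (lambert (u$2, u$3)) = 1" using norm_lambert u ab by simp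
    have "u $ 1 powr (1/3) \<le> 1" using u by (simp add: powr_le1)
    moreover have "sgn p = lambert (u$2, u$3)"
      using u n by (simp add: p lambert_ball_def sgn_scaleR) (simp add: sgn_div_norm)
    ultimately show "p \<in> C" using sub u n by (simp add: C_def p lambert_ball_def)
  qed
  have "emeasure lborel C \<le> emeasure lborel (cball 0 1 :: (real^3) set)"
    by (rule emeasure_mono) (auto simp: C_def)
  then have fin: "emeasure lborel C < \<infinity>"
    using emeasure_lborel_cball_finite le_less_trans by blast
  have "C \<in> lmeasurable"
    using C
    by (intro bounded_set_imp_lmeasurable)
       (auto simp: C_def intro!: bounded_subset[OF bounded_cball[of 0 1]])
  then have "4 / 3 * pi * (b - a) \<le> measure lebesgue C"
    using lambert_ball_image_box[OF ab] TC measure_mono_fmeasurable[of T C lebesgue]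
    by (auto simp: T_def fmeasurableD)
  also have "\<dots> = measure lborel C" using C by simp
  finally have le: "4 / 3 * pi * (b - a) \<le> measure lborel C" .
  have "emeasure sphere_measure B = emeasure lborel C / emeasure lborel (cball 0 1 :: (real^3) set)"
    unfolding C_def by (rule emeasure_sphere_measure[OF B])
  moreover have vol: "emeasure lborel (cball 0 1 :: (real^3) set) = ennreal (4 / 3 * pi)"
    by (simp only: emeasure_cball DIM_cart DIM_real) (simp add: unit_ball_vol_3)
  moreover have "emeasure lborel C / ennreal (4 / 3 * pi) = ennreal (measure lborel C / (4 / 3 * pi))"
    using fin by (simp add: emeasure_eq_ennreal_measure divide_ennreal)
  ultimately have "measure sphere_measure B = measure lborel C / (4 / 3 * pi)"
    by (simp add: measure_def)
  with le have "(4 / 3 * pi) * (b - a) \<le> (4 / 3 * pi) * measure sphere_measure B" by simp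
  then show ?thesis by (subst (asm) mult_le_cancel_left_pos) simp_all
qed

section \<open>The measure of polar caps\<close>

lemma spherical_cap_borel: "spherical_cap w t \<in> sets borel"
proof -
  have "closed {x. w \<bullet> x \<ge> t}"
    by (intro closed_Collect_le continuous_intros)
  moreover have "spherical_cap w t = sphere 0 1 \<inter> {x. w \<bullet> x \<ge> t}"
    by (auto simp: spherical_cap_def)
  ultimately show ?thesis by auto
qed

lemma measure_polar_cap:
  assumes "-1 \<le> t" "t \<le> 1"
  shows "measure sphere_measure (spherical_cap (axis 3 1) t) = (1 - t) / 2"
proof -
  interpret prob_space sphere_measure by (rule prob_space_sphere_measure)
  \<comment> \<open>In Lambert coordinates the cap is \<open>y \<le> ?b\<close> and its complement
    \<open>y > ?b\<close>.\<close>
  let ?C = "spherical_cap (axis 3 1) t" and ?b = "(1 - t) / 2"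
  have "?b - 0 \<le> prob ?C"
    using assms norm_lambert
    by (intro sphere_measure_ge) (auto simp: spherical_cap_borel, auto simp: spherical_cap_def inner_axis_3)
  moreover have "1 - ?b \<le> prob (sphere 0 1 - ?C)"
    using assms norm_lambert
    by (intro sphere_measure_ge) (auto simp: spherical_cap_borel, auto simp: spherical_cap_def inner_axis_3)
  moreover have "prob (sphere 0 1 - ?C) = 1 - prob ?C"
    using prob_compl[OF spherical_cap_in_sets] by (simp add: space_sphere_measure)
  ultimately show ?thesis by linarith
qed

section \<open>Shifted lattices in an arc\<close>

text \<open>Moving the window by one step trades the term at \<open>a\<close> for the equal term at
  \<open>a + int K\<close>.\<close>

lemma sum_periodic_window:
  fixes f :: "int \<Rightarrow> 'a::ab_group_add"
  assumes per: "\<And>i. f (i + int K) = f i"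
  shows "(\<Sum>i\<in>{a..<a + int K}. f i) = (\<Sum>i\<in>{0..<int K}. f i)"
proof -
  define W where "W a = (\<Sum>i\<in>{a..<a + int K}. f i)" for a
  have step: "W (a + 1) = W a" for a
  proof -
    have "{a..<a + int K + 1} = insert (a + int K) {a..<a + int K}"
      and "{a..<a + int K + 1} = insert a {a + 1..<a + 1 + int K}" by auto
    then have "insert (a + int K) {a..<a + int K} = insert a {a + 1..<a + 1 + int K}" by simp
    then have "(\<Sum>i\<in>insert (a + int K) {a..<a + int K}. f i) =
      (\<Sum>i\<in>insert a {a + 1..<a + 1 + int K}. f i)" by simp
    then show ?thesis by (simp add: W_def per)
  qed
  have "W a = W 0"
  proof (induction a rule: int_induct[where k = 0])
    case base
    show ?case by simp
  next
    case (step1 i)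
    with step[of i] show ?case by simp
  next
    case (step2 i)
    with step[of "i - 1"] show ?case by simp
  qed
  then show ?thesis by (simp add: W_def)
qed

text \<open>Over one period the condition selects the integers in a closed interval of length
  \<open>2 * h * K\<close>. Their number exceeds the length minus 1 and is at most the length plus
  1; the strictness on one side is what later makes two such counts differ by less than 2.\<close>

lemma count_cos_bounds:
  fixes x \<gamma> :: real
  assumes K: "K \<ge> 1" and \<gamma>: "-1 < \<gamma>" "\<gamma> \<le> 1"
  defines "h \<equiv> arccos \<gamma> / (2 * pi)"
    and "N \<equiv> (\<Sum>i<K. of_bool (\<gamma> \<le> cos (2 * pi * (x + real i / real K))) :: real)"
  shows "\<exists>n::int. N = of_int n" and "2 * h * K - 1 < N" and "N \<le> 2 * h * K + 1"
proof -
  \<comment> \<open>The \<open>K\<close> indices from \<open>a\<close> on are those with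
    \<open>x + i / K\<close> in [-1/2, 1/2). Among them \<open>b\<close> is the first and
    \<open>c\<close> the last one in the arc, if there is any.\<close>
  define a where "a = \<lceil>- real K / 2 - K * x\<rceil>"
  define b where "b = \<lceil>K * (- h - x)\<rceil>"
  define c where "c = \<lfloor>K * (h - x)\<rfloor>"
  have Kp: "real K > 0" using K by simp
  have h0: "0 \<le> h" using \<gamma> by (simp add: h_def arccos_lbound)
  have cos_h: "cos (2 * pi * h) = \<gamma>" using \<gamma> by (simp add: h_def)
  \<comment> \<open>As \<open>-1 < \<gamma>\<close>, the arc is not the full circle:
    \<open>h < 1 / 2\<close> keeps it away from the missing right end of the window.\<close>
  have "arccos \<gamma> \<noteq> pi"
    using \<gamma> cos_arccos[of \<gamma>] by (metis cos_pi less_imp_le less_irrefl)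
  moreover have "arccos \<gamma> \<le> pi" using \<gamma> by (intro arccos_ubound) auto
  ultimately have h1: "h < 1 / 2" by (simp add: h_def field_simps)
  have iff: "\<gamma> \<le> cos (2 * pi * u) \<longleftrightarrow> \<bar>u\<bar> \<le> h" if "\<bar>u\<bar> \<le> 1 / 2" for u
  proof -
    have "cos (2 * pi * u) = cos (2 * pi * \<bar>u\<bar>)" by (cases "u \<ge> 0") auto
    moreover have "cos (2 * pi * h) \<le> cos (2 * pi * \<bar>u\<bar>) \<longleftrightarrow> 2 * pi * \<bar>u\<bar> \<le> 2 * pi * h"
      using that h0 h1 by (intro cos_mono_le_eq) (auto simp: field_simps)
    ultimately show ?thesis by (simp add: cos_h)
  qed
  have mem: "(i \<in> {a..<a + int K} \<and> \<gamma> \<le> cos (2 * pi * (x + of_int i / K))) \<longleftrightarrow> i \<in> {b..c}" for i :: int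
  proof -
    let ?u = "x + of_int i / real K"
    have h': "\<bar>?u\<bar> \<le> h \<longleftrightarrow> K * (- h - x) \<le> of_int i \<and> of_int i \<le> K * (h - x)"
      using Kp by (auto simp: abs_le_iff field_simps)
    have "i \<in> {b..c} \<longleftrightarrow> \<bar>?u\<bar> \<le> h"
      unfolding h' b_def c_def by (simp add: ceiling_le_iff le_floor_iff)
    moreover have "i \<in> {a..<a + int K}" if "\<bar>?u\<bar> \<le> h"
    proof -
      have "K * h < K * (1/2)" using h1 Kp by (intro mult_strict_left_mono) auto
      then have "- real K / 2 - K * x \<le> of_int i" "of_int i < real K / 2 - K * x"
        using that unfolding h' by (auto simp: algebra_simps)
      moreover have "- real K / 2 - K * x \<le> of_int a" by (simp add: a_def)
      ultimately have "a \<le> i" "real_of_int i < of_int (a + int K)"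
        unfolding a_def ceiling_le_iff of_int_add of_int_of_nat_eq by linarith+
      then show ?thesis by simp
    qed
    moreover have "\<bar>?u\<bar> \<le> 1 / 2" if "i \<in> {a..<a + int K}"
    proof -
      have "real_of_int a \<le> of_int i" "real_of_int i \<le> of_int (a + int K - 1)" using that
        unfolding of_int_le_iff by auto
      moreover have "- real K / 2 - K * x \<le> of_int a" "of_int a < - real K / 2 - K * x + 1"
        unfolding a_def by linarith+
      ultimately have "- real K / 2 - K * x \<le> of_int i" "of_int i \<le> real K / 2 - K * x" by simp_all
      then show ?thesis using Kp unfolding abs_le_iff by (simp add: field_simps)
    qed
    ultimately show ?thesis using iff by blast
  qed
  let ?f = "\<lambda>i::int. of_bool (\<gamma> \<le> cos (2 * pi * (x + of_int i / K))) :: real"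
  have per: "?f (i + int K) = ?f i" for i
  proof -
    have "2 * pi * (x + of_int (i + int K) / K) = 2 * pi * (x + of_int i / K) + 2 * pi"
      using Kp by (simp add: field_simps)
    then show ?thesis by (simp only: cos_periodic)
  qed
  have "N = (\<Sum>i\<in>int ` {..<K}. ?f i)"
    by (subst sum.reindex) (simp_all add: N_def)
  also have "int ` {..<K} = {0..<int K}"
    by (simp add: lessThan_atLeast0 image_int_atLeastLessThan)
  also have "sum ?f {0..<int K} = sum ?f {a..<a + int K}"
    by (rule sum_periodic_window[symmetric]) (rule per)
  also have "\<dots> = real (card ({a..<a + int K} \<inter> {i. \<gamma> \<le> cos (2 * pi * (x + of_int i / K))}))"
    by simp
  also have "{a..<a + int K} \<inter> {i. \<gamma> \<le> cos (2 * pi * (x + of_int i / K))} = {b..c}"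
    using mem by (intro set_eqI) (simp only: Int_iff mem_Collect_eq)
  finally have N: "N = real (nat (c - b + 1))" by simp
  \<comment> \<open>If no integer lies in the interval, then \<open>c = b - 1\<close>, so
    \<open>nat\<close> truncates nothing.\<close>
  have "real K * (- h - x) \<le> real K * (h - x)" using h0 by (intro mult_left_mono) auto
  then have "real_of_int b < of_int (c + 2)" unfolding b_def c_def by linarith
  then have "b < c + 2" by linarith
  then have Nc: "N = of_int (c - b + 1)" using N by simp
  then show "\<exists>n::int. N = of_int n" by blast
  have "K * (h - x) - K * (- h - x) = 2 * h * K" by (simp add: algebra_simps)
  then show "2 * h * K - 1 < N" "N \<le> 2 * h * K + 1"
    unfolding Nc b_def c_def by linarith+
qed

text \<open>Dividing by \<open>A\<close> gives both counts the same arc. They are then integers in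
  the same half-open interval of length 2, so they differ by at most 1. Thresholds outside the range
  covered there give twice 0 or twice \<open>K\<close>.\<close>

lemma count_cos_diff:
  fixes A B x x' :: real
  assumes K: "K \<ge> 1" and A: "A \<ge> 0"
  shows "\<bar>(\<Sum>i<K. of_bool (B \<le> A * cos (2 * pi * (x + real i / real K)))) -
          (\<Sum>i<K. of_bool (B \<le> A * cos (2 * pi * (x' + real i / real K))))\<bar> \<le> (1::real)"
proof (cases "A = 0")
  case False
  with A have A: "A > 0" by simp
  define \<gamma> where "\<gamma> = B / A"
  have iff: "B \<le> A * c \<longleftrightarrow> \<gamma> \<le> c" for c using A by (simp add: \<gamma>_def field_simps)
  consider "\<gamma> \<le> -1" | "\<gamma> > 1" | "-1 < \<gamma>" "\<gamma> \<le> 1" by linarith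
  then show ?thesis
  proof cases
    case 1
    then have "\<gamma> \<le> cos u" for u using cos_ge_minus_one order_trans by blast
    then show ?thesis by (simp add: iff)
  next
    case 2
    then have "\<not> \<gamma> \<le> cos u" for u using cos_le_one[of u] by linarith
    then show ?thesis by (simp add: iff)
  next
    case 3
    note b = count_cos_bounds[OF K 3, folded iff]
    obtain m n :: int where
      m: "(\<Sum>i<K. of_bool (B \<le> A * cos (2 * pi * (x + real i / real K))) :: real) = of_int m" and
      n: "(\<Sum>i<K. of_bool (B \<le> A * cos (2 * pi * (x' + real i / real K))) :: real) = of_int n"
      using b(1) by metis
    have "real_of_int m < of_int (n + 2)" "real_of_int n < of_int (m + 2)"
      using b(2,3)[of x, unfolded m] b(2,3)[of x', unfolded n] by simp_all
    then have "m < n + 2" "n < m + 2" unfolding of_int_less_iff by auto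
    then show ?thesis unfolding m n by linarith
  qed
qed simp

section \<open>Meridians\<close>

text \<open>A straddled band strictly between two others would have a point where \<open>P\<close>
  fails between points of the outer bands where \<open>P\<close> holds. So only the first and the
  last straddled band exist.\<close>

lemma card_straddled_bands_le_2:
  fixes P :: "real \<Rightarrow> bool" and K :: nat
  assumes P: "\<And>a b y. 0 \<le> a \<Longrightarrow> a \<le> y \<Longrightarrow> y \<le> b \<Longrightarrow> b \<le> 1 \<Longrightarrow> P a \<Longrightarrow> P b \<Longrightarrow> P y"
  defines "I \<equiv> \<lambda>j. {real j / real K <.. real (j + 1) / real K}"
  shows "card {j\<in>{..<K}. \<exists>y\<in>I j. \<exists>y'\<in>I j. P y \<and> \<not> P y'} \<le> 2" (is "card ?T \<le> 2")
proof -
  have "?T \<subseteq> {Min ?T, Max ?T}"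
  proof
    fix j assume j: "j \<in> ?T"
    have fin: "finite ?T" by simp
    have mem: "Min ?T \<in> ?T" "Max ?T \<in> ?T" using Min_in[OF fin] Max_in[OF fin] j by blast+
    have le: "Min ?T \<le> j" "j \<le> Max ?T" using Min_le[OF fin j] Max_ge[OF fin j] by blast+
    have K: "real K > 0" using j by auto
    have sep: "u < v" if "u \<in> I i" "v \<in> I k" "i < k" for u v i k
    proof -
      have "u \<le> real (i + 1) / K" using that by (simp add: I_def)
      also have "\<dots> \<le> real k / K" using that K by (intro divide_right_mono) auto
      also have "\<dots> < v" using that by (simp add: I_def)
      finally show ?thesis .
    qed
    have unit: "0 \<le> u \<and> u \<le> 1" if "u \<in> I i" "i < K" for u i
    proof -
      have "0 \<le> real i / K" by simp
      moreover have "real (i + 1) / K \<le> 1" using that K by (subst divide_le_eq_1_pos) auto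
      ultimately show ?thesis using that unfolding I_def greaterThanAtMost_iff by linarith
    qed
    show "j \<in> {Min ?T, Max ?T}"
    proof (rule ccontr)
      assume "j \<notin> {Min ?T, Max ?T}"
      with le have lt: "Min ?T < j" "j < Max ?T" by auto
      obtain a where a: "a \<in> I (Min ?T)" "P a" using mem(1) by blast
      obtain b where b: "b \<in> I (Max ?T)" "P b" using mem(2) by blast
      obtain y where y: "y \<in> I j" "\<not> P y" using j by blast
      have "P y"
        using P[of a y b] sep[OF a(1) y(1) lt(1)] sep[OF y(1) b(1) lt(2)]
          unit[OF a(1)] unit[OF b(1)] mem a b by auto
      with y show False by simp
    qed
  qed
  then have "card ?T \<le> card {Min ?T, Max ?T}" by (intro card_mono) auto
  also have "\<dots> \<le> 2" by (simp add: card_insert_if)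
  finally show ?thesis .
qed

text \<open>The graph of \<open>sqrt (y - y\<^sup>2)\<close> is a half circle, hence
  concave.\<close>

lemma sqrt_diff_square_concave:
  fixes a b u v :: real
  assumes "0 \<le> a" "a \<le> 1" "0 \<le> b" "b \<le> 1" "0 \<le> u" "0 \<le> v" "u + v = 1"
  shows "u * sqrt (a - a\<^sup>2) + v * sqrt (b - b\<^sup>2) \<le> sqrt ((u * a + v * b) - (u * a + v * b)\<^sup>2)"
proof (rule real_le_rsqrt)
  define \<alpha> where "\<alpha> = sqrt (a - a\<^sup>2)"
  define \<beta> where "\<beta> = sqrt (b - b\<^sup>2)"
  have sq: "\<alpha>\<^sup>2 = a - a\<^sup>2" "\<beta>\<^sup>2 = b - b\<^sup>2" using diff_square_nonneg assms by (simp_all add: \<alpha>_def \<beta>_def)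
  have u: "u = 1 - v" using assms by simp
  \<comment> \<open>A squared mean falls short of the mean of the squares by \<open>u * v\<close>
    times the squared difference. This is used twice: the shortfall for \<open>\<alpha>\<close>,
    \<open>\<beta>\<close> is dropped, the one for \<open>a\<close>, \<open>b\<close> is
    added.\<close>
  have "(u * \<alpha> + v * \<beta>)\<^sup>2 = u * \<alpha>\<^sup>2 + v * \<beta>\<^sup>2 - u * v * (\<alpha> - \<beta>)\<^sup>2"
    unfolding u by (simp add: power2_eq_square algebra_simps)
  also have "\<dots> \<le> u * (a - a\<^sup>2) + v * (b - b\<^sup>2) + u * v * (a - b)\<^sup>2"
    using assms by (simp add: sq)
       (smt (verit) mult_nonneg_nonneg zero_le_power2)
  also have "\<dots> = (u * a + v * b) - (u * a + v * b)\<^sup>2"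
    unfolding u by (simp add: power2_eq_square algebra_simps)
  finally show "(u * sqrt (a - a\<^sup>2) + v * sqrt (b - b\<^sup>2))\<^sup>2 \<le> (u * a + v * b) - (u * a + v * b)\<^sup>2"
    by (simp add: \<alpha>_def \<beta>_def)
qed

text \<open>The inner product with a fixed vector has the form of \<open>f\<close> along a meridian.
  By concavity \<open>f\<close> does not fall below its smaller end value, so its superlevel sets
  are intervals.\<close>

lemma sqrt_diff_square_plus_linear_ge_min:
  fixes A c d :: real
  assumes "0 \<le> A" "0 \<le> a" "a \<le> y" "y \<le> b" "b \<le> 1"
  defines "f \<equiv> \<lambda>y. A * sqrt (y - y\<^sup>2) + c * y + d"
  shows "min (f a) (f b) \<le> f y"
proof -
  obtain u v where uv: "0 \<le> u" "0 \<le> v" "u + v = 1" "y = u * a + v * b"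
  \<comment> \<open>For \<open>a = b\<close> the quotients below would both be 0 and not add up to
    1.\<close>
  proof (cases "a = b")
    case True
    then show ?thesis using that[of 1 0] assms by simp
  next
    case False
    with assms have ab: "b - a > 0" by simp
    have "(b - y) / (b - a) * a + (y - a) / (b - a) * b = y * (b - a) / (b - a)"
      by (simp add: algebra_simps flip: add_divide_distrib diff_divide_distrib)
    moreover have "(b - y) / (b - a) + (y - a) / (b - a) = 1"
      using ab by (simp flip: add_divide_distrib)
    ultimately show ?thesis using assms(1-5) ab
      by (intro that[of "(b - y) / (b - a)" "(y - a) / (b - a)"]) auto
  qed
  have "u * min (f a) (f b) + v * min (f a) (f b) \<le> u * f a + v * f b"
    using uv by (intro add_mono mult_left_mono) auto
  then have "min (f a) (f b) \<le> u * f a + v * f b"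
    using uv by (metis distrib_right mult_1)
  also have "\<dots> = A * (u * sqrt (a - a\<^sup>2) + v * sqrt (b - b\<^sup>2)) + c * y + (u + v) * d"
    unfolding f_def uv(4) by (simp add: algebra_simps)
  also have "\<dots> \<le> f y"
    unfolding f_def using sqrt_diff_square_concave[of a b u v] uv assms
    by (simp add: mult_left_mono)
  finally show ?thesis .
qed

section \<open>Averaging over rotations\<close>

lemma polar_nonneg:
  obtains r \<phi> :: real where "0 \<le> r" "a = r * cos \<phi>" "b = r * sin \<phi>"
proof -
  obtain s \<theta> :: real where s: "a = s * cos \<theta>" "b = s * sin \<theta>" using polar_Ex by blast
  show thesis
  proof (cases "0 \<le> s")
    case True
    with s that show thesis by blast
  next
    case False
    with s that[of "-s" "\<theta> + pi"] show thesis by simp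
  qed
qed

text \<open>The half-open intervals leave out only the north pole.\<close>
definition band :: "nat \<Rightarrow> nat \<Rightarrow> (real^3) set" where
  "band K j = spherical_cap (axis 3 1) (1 - 2 * (real (j + 1) / real K))
     - spherical_cap (axis 3 1) (1 - 2 * (real j / real K))"

definition band_interval :: "nat \<Rightarrow> nat \<Rightarrow> real set" where
  "band_interval K j = {real j / real K <.. real (j + 1) / real K}"

lemma band_interval_unit: "0 \<le> y \<and> y \<le> 1" if "y \<in> band_interval K j" "j < K"
proof -
  have "0 \<le> real j / K" by simp
  moreover have "real (j + 1) / K \<le> 1" using that by (subst divide_le_eq_1_pos) auto
  ultimately show ?thesis using that unfolding band_interval_def greaterThanAtMost_iff by linarith
qed

lemma mem_band_iff: "p \<in> band K j \<longleftrightarrow> norm p = 1 \<and> (1 - p $ 3) / 2 \<in> band_interval K j"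
proof -
  define a where "a = real j / real K"
  define b where "b = real (j + 1) / real K"
  have "p \<in> band K j \<longleftrightarrow> norm p = 1 \<and> 1 - 2 * b \<le> p $ 3 \<and> \<not> 1 - 2 * a \<le> p $ 3"
    unfolding band_def spherical_cap_def inner_axis_3 a_def[symmetric] b_def[symmetric] by auto
  also have "\<dots> \<longleftrightarrow> norm p = 1 \<and> (1 - p $ 3) / 2 \<in> {a <.. b}"
    by auto
  finally show ?thesis unfolding band_interval_def a_def b_def .
qed

lemma band_borel: "band K j \<in> sets borel"
  unfolding band_def by (intro sets.Diff spherical_cap_borel)

lemma sets_sphere_measureI: "A \<in> sets sphere_measure" if "A \<in> sets borel" "A \<subseteq> sphere 0 1"
proof -
  have "A = sphere 0 1 \<inter> A" using that by blast
  then show ?thesis using that unfolding sets_sphere_measure sets_restrict_space by blast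
qed

lemma band_subset: "band K j \<subseteq> sphere 0 1"
  by (auto simp: mem_band_iff)

lemma spherical_cap_antimono: "s \<le> t \<Longrightarrow> spherical_cap w t \<subseteq> spherical_cap w s"
  by (auto simp: spherical_cap_def)

lemma measure_band: "measure sphere_measure (band K j) = 1 / K" if "j < K"
proof -
  interpret prob_space sphere_measure by (rule prob_space_sphere_measure)
  define a where "a = real j / real K"
  define b where "b = real (j + 1) / real K"
  have ab: "0 \<le> a" "a \<le> b" "b \<le> 1" "b - a = 1 / K"
    using that by (auto simp: a_def b_def field_simps)
  have "prob (band K j) =
      prob (spherical_cap (axis 3 1) (1 - 2 * b)) - prob (spherical_cap (axis 3 1) (1 - 2 * a))"
    unfolding band_def a_def[symmetric] b_def[symmetric] using ab
    by (intro finite_measure_Diff spherical_cap_in_sets spherical_cap_antimono) simp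
  also have "\<dots> = b - a"
    using ab by (simp add: measure_polar_cap)
  finally show ?thesis using ab by simp
qed

text \<open>Polar coordinates of the horizontal part supply the longitude; their radius is the one
  prescribed by the height. The poles are included, with radius 0.\<close>

lemma lambert_surj:
  assumes "norm p = 1"
  obtains x where "p = lambert (x, (1 - p $ 3) / 2)"
proof -
  obtain r \<phi> where r: "0 \<le> r" "p $ 1 = r * cos \<phi>" "p $ 2 = r * sin \<phi>" by (rule polar_nonneg)
  let ?y = "(1 - p $ 3) / 2"
  have "p $ 1 * p $ 1 + p $ 2 * p $ 2 + p $ 3 * p $ 3 = 1"
    using assms by (simp add: norm_eq_1 inner_vec3)
  moreover have "p $ 1 * p $ 1 + p $ 2 * p $ 2 = r\<^sup>2 * ((cos \<phi>)\<^sup>2 + (sin \<phi>)\<^sup>2)"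
    unfolding r by algebra
  ultimately have "r\<^sup>2 = 1 - (p $ 3)\<^sup>2" by (simp add: power2_eq_square)
  then have "?y - ?y\<^sup>2 = (r / 2)\<^sup>2" by (simp add: power2_eq_square field_simps)
  then have "sqrt (?y - ?y\<^sup>2) = r / 2" using r by simp
  then have "p = lambert (\<phi> / (2 * pi), ?y)"
    by (simp add: vec_eq_iff forall_3 r(2,3)) (simp add: field_simps)
  then show thesis by (rule that)
qed

section \<open>Rotations about the z-axis and the counts of rotates in a cap\<close>

definition rotate_z :: "real \<Rightarrow> real^3 \<Rightarrow> real^3" where
  "rotate_z \<alpha> p = vector [cos \<alpha> * p $ 1 - sin \<alpha> * p $ 2, sin \<alpha> * p $ 1 + cos \<alpha> * p $ 2, p $ 3]"

lemma orthogonal_rotate_z: "orthogonal_transformation (rotate_z \<alpha>)"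
  unfolding orthogonal_transformation
proof (intro conjI allI)
  show "linear (rotate_z \<alpha>)"
    by (rule linearI) (simp_all add: rotate_z_def vec_eq_iff forall_3 algebra_simps)
  fix p
  have "rotate_z \<alpha> p \<bullet> rotate_z \<alpha> p =
    ((cos \<alpha>)\<^sup>2 + (sin \<alpha>)\<^sup>2) * (p $ 1 * p $ 1 + p $ 2 * p $ 2) + p $ 3 * p $ 3"
    unfolding inner_vec3 rotate_z_def vector_3 by algebra
  then show "norm (rotate_z \<alpha> p) = norm p"
    by (simp add: norm_eq_sqrt_inner inner_vec3)
qed

lemma rotate_z_lambert: "rotate_z (2 * pi * \<beta>) (lambert (x, y)) = lambert (x + \<beta>, y)"
  by (simp add: rotate_z_def vec_eq_iff forall_3 distrib_left cos_add sin_add algebra_simps)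

text \<open>This is the number n(p) for \<open>p = lambert (x, y)\<close>: rotation by
  \<open>2 * pi * i / K\<close> adds \<open>i / K\<close> to the longitude. At a grid point it
  counts the points of its row in the cap.\<close>

definition row_count :: "nat \<Rightarrow> real^3 \<Rightarrow> real \<Rightarrow> real \<Rightarrow> real \<Rightarrow> real" where
  "row_count K w t x y = (\<Sum>i<K. of_bool (t \<le> w \<bullet> lambert (x + real i / real K, y)))"

lemma inner_lambert:
  "w \<bullet> lambert (x, y) = 2 * (w $ 1 * cos (2 * pi * x) + w $ 2 * sin (2 * pi * x)) * sqrt (y - y\<^sup>2)
     + (- 2 * w $ 3) * y + w $ 3"
  by (simp add: inner_vec3 algebra_simps)

text \<open>With the horizontal part of \<open>w\<close> in polar form, the inner product along a
  parallel is a constant plus a nonnegative multiple of a shifted cosine, so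
  \<open>count_cos_diff\<close> applies.\<close>

lemma row_count_shift:
  assumes "K \<ge> 1" "0 \<le> y" "y \<le> 1"
  shows "\<bar>row_count K w t x y - row_count K w t x' y\<bar> \<le> 1"
proof -
  obtain r \<phi> where r: "0 \<le> r" "w $ 1 = r * cos \<phi>" "w $ 2 = r * sin \<phi>" by (rule polar_nonneg)
  define A where "A = 2 * sqrt (y - y\<^sup>2) * r"
  define B where "B = t - w $ 3 * (1 - 2 * y)"
  have iff: "t \<le> w \<bullet> lambert (x, y) \<longleftrightarrow> B \<le> A * cos (2 * pi * (x - \<phi> / (2 * pi)))" for x
  proof -
    have "2 * pi * (x - \<phi> / (2 * pi)) = 2 * pi * x - \<phi>" by (simp add: field_simps)
    then have "w \<bullet> lambert (x, y) = A * cos (2 * pi * (x - \<phi> / (2 * pi))) + w $ 3 * (1 - 2 * y)"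
      by (simp only: cos_diff) (simp add: inner_lambert A_def r algebra_simps)
    then show ?thesis by (auto simp: B_def)
  qed
  have "A \<ge> 0" using r diff_square_nonneg assms by (simp add: A_def)
  from count_cos_diff[OF assms(1) this, of B "x - \<phi> / (2 * pi)" "x' - \<phi> / (2 * pi)"]
  show ?thesis by (simp only: row_count_def iff add_diff_eq diff_add_eq)
qed

definition straddles :: "nat \<Rightarrow> real^3 \<Rightarrow> real \<Rightarrow> real \<Rightarrow> nat \<Rightarrow> bool" where
  "straddles K w t x j \<longleftrightarrow> (\<exists>y\<in>band_interval K j. \<exists>y'\<in>band_interval K j.
     t \<le> w \<bullet> lambert (x, y) \<and> \<not> t \<le> w \<bullet> lambert (x, y'))"

text \<open>The sign of the coefficient \<open>A\<close> of the square root decides: if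
  \<open>A \<ge> 0\<close>, the inner product is concave in \<open>y\<close> and the points inside
  the cap form an interval; otherwise its negative is concave and the points outside do. Straddling
  is symmetric in inside and outside.\<close>

lemma sum_straddles_le_2: "(\<Sum>j<K. of_bool (straddles K w t x j)) \<le> (2::real)"
proof -
  define A where "A = 2 * (w $ 1 * cos (2 * pi * x) + w $ 2 * sin (2 * pi * x))"
  define f where "f y = w \<bullet> lambert (x, y)" for y
  have f: "f y = A * sqrt (y - y\<^sup>2) + (- 2 * w $ 3) * y + w $ 3" for y
    by (simp only: f_def A_def inner_lambert)
  have "card {j\<in>{..<K}. straddles K w t x j} \<le> 2"
  proof (cases "A \<ge> 0")
    case True
    have "t \<le> f y" if "0 \<le> a" "a \<le> y" "y \<le> b" "b \<le> 1" "t \<le> f a" "t \<le> f b" for a b y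
      using sqrt_diff_square_plus_linear_ge_min[OF True that(1-4), of "- 2 * w $ 3" "w $ 3"] that(5,6)
      unfolding f by linarith
    from card_straddled_bands_le_2[of "\<lambda>y. t \<le> f y", OF this]
    show ?thesis by (simp add: straddles_def band_interval_def f_def)
  next
    case False
    then have A: "- A \<ge> 0" by simp
    have "\<not> t \<le> f y" if "0 \<le> a" "a \<le> y" "y \<le> b" "b \<le> 1" "\<not> t \<le> f a" "\<not> t \<le> f b" for a b y
      using sqrt_diff_square_plus_linear_ge_min[OF A that(1-4), of "2 * w $ 3" "- w $ 3"] that(5,6)
      unfolding f by linarith
    from card_straddled_bands_le_2[of "\<lambda>y. \<not> t \<le> f y", OF this]
    have "card {j\<in>{..<K}. \<exists>y\<in>band_interval K j. \<exists>y'\<in>band_interval K j. \<not> t \<le> f y \<and> \<not> \<not> t \<le> f y'} \<le> 2"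
      unfolding band_interval_def .
    also have "{j\<in>{..<K}. \<exists>y\<in>band_interval K j. \<exists>y'\<in>band_interval K j. \<not> t \<le> f y \<and> \<not> \<not> t \<le> f y'} =
       {j\<in>{..<K}. straddles K w t x j}"
      unfolding straddles_def f_def by blast
    finally show ?thesis .
  qed
  moreover have "{j\<in>{..<K}. straddles K w t x j} = {..<K} \<inter> {j. straddles K w t x j}" by auto
  ultimately show ?thesis by simp
qed

text \<open>A rotate can contribute differently at \<open>y\<close> and \<open>y'\<close> only if
  its meridian straddles the band.\<close>

lemma row_count_band:
  assumes "y \<in> band_interval K j" "y' \<in> band_interval K j"
  shows "\<bar>row_count K w t x y - row_count K w t x y'\<bar>
    \<le> (\<Sum>i<K. of_bool (straddles K w t (x + real i / real K) j))"
proof -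
  have "\<bar>row_count K w t x y - row_count K w t x y'\<bar> \<le>
    (\<Sum>i<K. \<bar>of_bool (t \<le> w \<bullet> lambert (x + real i / real K, y))
       - of_bool (t \<le> w \<bullet> lambert (x + real i / real K, y'))\<bar>)"
    unfolding row_count_def sum_subtractf[symmetric] by (rule sum_abs)
  also have "\<dots> \<le> (\<Sum>i<K. of_bool (straddles K w t (x + real i / real K) j))"
  proof (rule sum_mono)
    fix i
    show "\<bar>of_bool (t \<le> w \<bullet> lambert (x + real i / real K, y))
        - of_bool (t \<le> w \<bullet> lambert (x + real i / real K, y'))\<bar>
      \<le> (of_bool (straddles K w t (x + real i / real K) j) :: real)"
      using assms unfolding straddles_def of_bool_def by auto
  qed
  finally show ?thesis .
qed

text \<open>The \<open>K\<close> rotated copies of the cap within the band all have the same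
  measure, and their indicators add up to the row count at each point of the band. Integrating the
  bounds over the band, of measure \<open>1 / K\<close>, gives the claim; the factor is
  \<open>K\<close> for the copies times \<open>K\<close> for the band.\<close>

lemma measure_cap_Int_band_bounds:
  assumes j: "j < K"
    and n: "\<And>x y. y \<in> band_interval K j \<Longrightarrow> lo \<le> row_count K w t x y \<and> row_count K w t x y \<le> hi"
  shows "lo \<le> (real K)\<^sup>2 * measure sphere_measure (spherical_cap w t \<inter> band K j)"
    and "(real K)\<^sup>2 * measure sphere_measure (spherical_cap w t \<inter> band K j) \<le> hi"
proof -
  interpret prob_space sphere_measure by (rule prob_space_sphere_measure)
  let ?C = "spherical_cap w t" and ?Z = "band K j"
  define R where "R i = rotate_z (2 * pi * (real i / real K))" for i
  define E where "E i = R i -` (?C \<inter> ?Z)" for i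
  have CZ: "?C \<inter> ?Z \<in> sets borel" "?C \<inter> ?Z \<subseteq> sphere 0 1"
    using spherical_cap_borel band_borel band_subset by (blast intro: sets.Int)+
  have prob_E: "prob (E i) = prob (?C \<inter> ?Z)" for i
    unfolding E_def R_def by (rule measure_sphere_measure_orthogonal[OF orthogonal_rotate_z CZ])
  have "linear (R i)" for i
    unfolding R_def using orthogonal_rotate_z orthogonal_transformation_linear by blast
  then have "R i \<in> borel_measurable borel" for i
    by (intro borel_measurable_continuous_onI linear_continuous_on) (simp add: linear_conv_bounded_linear)
  then have E_borel: "E i \<in> sets borel" for i
    using measurable_sets[of "R i" borel borel "?C \<inter> ?Z"] CZ by (simp add: E_def)
  have norm_R: "norm (R i p) = norm p" for i p
    unfolding R_def by (rule orthogonal_transformation_norm[OF orthogonal_rotate_z])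
  have "p \<in> sphere 0 1" if "p \<in> E i" for i p
  proof -
    have "R i p \<in> sphere 0 1" using that CZ(2) unfolding E_def by blast
    then show ?thesis by (simp only: mem_sphere_0 norm_R)
  qed
  then have E: "E i \<in> events" for i
    by (intro sets_sphere_measureI E_borel) blast
  have Z: "?Z \<in> events" by (intro sets_sphere_measureI band_borel band_subset)
  have R3: "R i p $ 3 = p $ 3" for i p by (simp add: R_def rotate_z_def)
  \<comment> \<open>Rotation preserves the band, so for \<open>p\<close> in it,
    \<open>p \<in> E i\<close> says just that the \<open>i\<close>-th rotate of \<open>p\<close>
    lies in the cap.\<close>
  have mid: "lo * indicator ?Z p \<le> (\<Sum>i<K. indicator (E i) p)
      \<and> (\<Sum>i<K. indicator (E i) p) \<le> hi * indicator ?Z p" for p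
  proof (cases "p \<in> ?Z")
    case True
    then have p: "norm p = 1" "(1 - p $ 3) / 2 \<in> band_interval K j" by (auto simp: mem_band_iff)
    obtain x where x: "p = lambert (x, (1 - p $ 3) / 2)" using lambert_surj p(1) .
    have RZ: "R i p \<in> ?Z" for i using True by (simp add: mem_band_iff R3 norm_R)
    have "indicator (E i) p = (of_bool (t \<le> w \<bullet> lambert (x + real i / real K, (1 - p $ 3) / 2)) :: real)" for i
    proof -
      have "R i p = lambert (x + real i / real K, (1 - p $ 3) / 2)"
        unfolding R_def by (subst (1) x) (rule rotate_z_lambert)
      then have "p \<in> E i \<longleftrightarrow> t \<le> w \<bullet> lambert (x + real i / real K, (1 - p $ 3) / 2)"
        using RZ[of i] p(1) norm_R[of i p] by (simp add: E_def spherical_cap_def)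
      then show ?thesis by (simp add: indicator_def)
    qed
    then have "(\<Sum>i<K. indicator (E i) p) = row_count K w t x ((1 - p $ 3) / 2)"
      by (simp add: row_count_def)
    with n[OF p(2)] True show ?thesis by simp
  next
    case False
    then have "p \<notin> E i" for i by (auto simp: E_def mem_band_iff R3 norm_R)
    with False show ?thesis by simp
  qed
  have int_ind: "integrable sphere_measure (indicator A :: _ \<Rightarrow> real)" if "A \<in> events" for A
    using that by (intro integrable_real_indicator) (simp_all add: emeasure_eq_measure)
  have int: "expectation (\<lambda>p. \<Sum>i<K. indicator (E i) p) = real K * prob (?C \<inter> ?Z)"
    using E int_ind by (subst Bochner_Integration.integral_sum) (simp_all add: prob_E)
  have intZ: "expectation (\<lambda>p. c * indicator ?Z p) = c / K" for c
    using Z measure_band[OF j] by simp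
  have iE: "integrable sphere_measure (\<lambda>p. \<Sum>i<K. indicator (E i) p :: real)"
    using E int_ind by (intro Bochner_Integration.integrable_sum) simp
  have iZ: "integrable sphere_measure (\<lambda>p. c * indicator ?Z p :: real)" for c
    using Z int_ind by (intro integrable_mult_right) simp
  have "lo / K \<le> real K * prob (?C \<inter> ?Z)"
    using integral_mono[OF iZ iE] mid unfolding int intZ by blast
  moreover have "real K * prob (?C \<inter> ?Z) \<le> hi / K"
    using integral_mono[OF iE iZ] mid unfolding int intZ by blast
  ultimately show "lo \<le> (real K)\<^sup>2 * prob (?C \<inter> ?Z)" "(real K)\<^sup>2 * prob (?C \<inter> ?Z) \<le> hi"
    using j by (simp_all add: field_simps power2_eq_square)
qed

text \<open>The bands partition the sphere without the north pole, which is a degenerate polar cap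
  and hence a null set.\<close>

lemma measure_cap_eq_sum_bands:
  assumes "K \<ge> 1"
  shows "measure sphere_measure (spherical_cap w t) =
    (\<Sum>j<K. measure sphere_measure (spherical_cap w t \<inter> band K j))"
proof -
  interpret prob_space sphere_measure by (rule prob_space_sphere_measure)
  let ?C = "spherical_cap w t" and ?N = "spherical_cap (axis 3 1) 1"
  have K: "real K > 0" using assms by simp
  have "sphere 0 1 \<subseteq> (\<Union>j<K. band K j) \<union> ?N"
  proof
    fix p :: "real^3" assume p: "p \<in> sphere 0 1"
    define y where "y = (1 - p $ 3) / 2"
    have "\<bar>p $ 3\<bar> \<le> 1" using p component_le_norm_cart[of p 3] by simp
    then have y: "0 \<le> y" "y \<le> 1" by (auto simp: y_def)
    show "p \<in> (\<Union>j<K. band K j) \<union> ?N"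
    proof (cases "y = 0")
      case True
      with p show ?thesis by (simp add: y_def spherical_cap_def inner_axis_3)
    next
      case False
      with y have y: "0 < y" "y \<le> 1" by auto
      \<comment> \<open>The intervals contain their right ends, hence ceiling minus 1 and not the
        floor.\<close>
      define j where "j = nat (\<lceil>K * y\<rceil> - 1)"
      have pos: "0 < K * y" using y K by simp
      have "\<lceil>K * y\<rceil> \<ge> 1" using pos by linarith
      then have j: "real j = of_int \<lceil>K * y\<rceil> - 1" by (simp add: j_def)
      have "real K * y \<le> real K * 1" using y K by (intro mult_left_mono) auto
      then have "real j < K" "real j < K * y" "K * y \<le> real (j + 1)"
        using j by (simp_all, linarith+)
      then have "j < K" "y \<in> band_interval K j"
        using K by (auto simp: band_interval_def field_simps)
      with p show ?thesis by (auto simp: mem_band_iff y_def)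
    qed
  qed
  then have cover: "?C = (\<Union>j<K. ?C \<inter> band K j) \<union> (?C \<inter> ?N)"
    by (auto simp: spherical_cap_def)
  have ev: "band K j \<in> events" for j by (intro sets_sphere_measureI band_borel band_subset)
  have disj: "disjoint_family_on (\<lambda>j. ?C \<inter> band K j) {..<K}"
  proof -
    have "j = k" if "p \<in> band K j" "p \<in> band K k" for j k p
    proof -
      have "real j / K < real (k + 1) / K" "real k / K < real (j + 1) / K"
        using that unfolding mem_band_iff band_interval_def greaterThanAtMost_iff by linarith+
      then have "real j < real (k + 1)" "real k < real (j + 1)"
        using K by (simp_all add: divide_less_cancel)
      then show ?thesis by simp
    qed
    then show ?thesis unfolding disjoint_family_on_def by blast
  qed
  have evC: "?C \<in> events" "?N \<in> events" by (rule spherical_cap_in_sets)+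
  have "prob ?N = 0" by (simp add: measure_polar_cap)
  then have "prob (?C \<inter> ?N) = 0"
    using finite_measure_mono[of "?C \<inter> ?N" ?N] evC by (simp add: measure_le_0_iff)
  then have "prob ?C = prob (\<Union>j<K. ?C \<inter> band K j)"
    using evC ev by (subst cover) (intro measure_Un_null_set, auto simp: null_sets_def emeasure_eq_measure)
  also have "\<dots> = (\<Sum>j<K. prob (?C \<inter> band K j))"
    using evC ev disj by (intro finite_measure_finite_Union) auto
  finally show ?thesis .
qed

section \<open>The grid\<close>

text \<open>The shift by half a step keeps the grid off the boundary, so the half-open and the open
  side of the square both select the indices from 0 to \<open>K - 1\<close>.\<close>

lemma shifted_grid_eq:
  assumes "K \<ge> 1"
  shows "shifted_grid K = (\<lambda>(i, j). ((real i + 1 / 2) / K, (real j + 1 / 2) / K)) ` ({..<K} \<times> {..<K})"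
proof -
  have K: "real K > 0" using assms by simp
  have half: "of_int m / real K + 1 / (2 * real K) = (of_int m + 1 / 2) / K" for m :: int
    using K by (simp add: field_simps)
  have unit: "0 \<le> (of_int m + 1 / 2) / real K \<and> (of_int m + 1 / 2) / real K < 1 \<longleftrightarrow> m \<in> int ` {..<K}"
      "0 < (of_int m + 1 / 2) / real K \<and> (of_int m + 1 / 2) / real K < 1 \<longleftrightarrow> m \<in> int ` {..<K}" for m :: int
  proof -
    have "int ` {..<K} = {0..<int K}"
      by (simp add: lessThan_atLeast0 image_int_atLeastLessThan)
    then have "m \<in> int ` {..<K} \<longleftrightarrow> 0 \<le> m \<and> m < int K" by simp
    then show "0 \<le> (of_int m + 1 / 2) / real K \<and> (of_int m + 1 / 2) / real K < 1 \<longleftrightarrow> m \<in> int ` {..<K}"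
      "0 < (of_int m + 1 / 2) / real K \<and> (of_int m + 1 / 2) / real K < 1 \<longleftrightarrow> m \<in> int ` {..<K}"
      using K by (simp_all add: zero_le_divide_iff zero_less_divide_iff divide_less_eq) linarith+
  qed
  have "shifted_grid K = {((of_int m + 1 / 2) / K, (of_int n + 1 / 2) / K) | m n.
    m \<in> int ` {..<K} \<and> n \<in> int ` {..<K}}"
  proof -
    have "((of_int m + 1 / 2) / real K, (of_int n + 1 / 2) / real K) \<in> {0..<1} \<times> {0<..<1} \<longleftrightarrow>
        m \<in> int ` {..<K} \<and> n \<in> int ` {..<K}" for m n :: int
      by (simp only: mem_Times_iff fst_conv snd_conv atLeastLessThan_iff greaterThanLessThan_iff unit)
    then show ?thesis unfolding shifted_grid_def half by blast
  qed
  also have "\<dots> = (\<lambda>(i, j). ((real i + 1 / 2) / K, (real j + 1 / 2) / K)) ` ({..<K} \<times> {..<K})"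
    by (force simp: image_iff)
  finally show ?thesis .
qed

lemma inj_on_grid:
  assumes "K \<ge> 1"
  shows "inj_on (\<lambda>(i, j). lambert ((real i + 1 / 2) / K, (real j + 1 / 2) / K)) ({..<K} \<times> {..<K})"
proof (rule inj_onI, clarify)
  fix i j i' j'
  assume ij: "i < K" "j < K" "i' < K" "j' < K"
    and eq: "lambert ((real i + 1 / 2) / K, (real j + 1 / 2) / K) =
      lambert ((real i' + 1 / 2) / K, (real j' + 1 / 2) / K)"
  have unit: "0 < (real k + 1 / 2) / K \<and> (real k + 1 / 2) / K < 1" if "k < K" for k
    using that by (auto simp: field_simps)
  have "(real i + 1 / 2) / K = (real i' + 1 / 2) / K \<and> (real j + 1 / 2) / K = (real j' + 1 / 2) / K"
    using eq unit ij by (subst (asm) lambert_eq_iff) (auto intro: less_imp_le)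
  then show "i = i' \<and> j = j'" using assms by simp
qed

lemma
  assumes "K \<ge> 1"
  shows card_shifted_grid: "card (shifted_grid K) = K\<^sup>2"
    and card_lambert_shifted_grid: "card (lambert ` shifted_grid K) = K\<^sup>2"
    and sum_lambert_shifted_grid: "(\<Sum>p\<in>lambert ` shifted_grid K. indicator (spherical_cap w t) p) =
      (\<Sum>j<K. row_count K w t (1 / (2 * real K)) ((real j + 1 / 2) / K))"
proof -
  let ?g = "\<lambda>(i, j). ((real i + 1 / 2) / real K, (real j + 1 / 2) / real K)"
  let ?h = "\<lambda>(i, j). lambert ((real i + 1 / 2) / real K, (real j + 1 / 2) / real K)"
  have im: "lambert ` shifted_grid K = ?h ` ({..<K} \<times> {..<K})"
    unfolding shifted_grid_eq[OF assms] image_image by (simp add: case_prod_unfold)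
  show c: "card (lambert ` shifted_grid K) = K\<^sup>2"
    unfolding im card_image[OF inj_on_grid[OF assms]] by (simp add: power2_eq_square)
  \<comment> \<open>The size of the grid is squeezed between those of its image and of its index
    set.\<close>
  have "card (lambert ` shifted_grid K) \<le> card (shifted_grid K)"
    unfolding shifted_grid_eq[OF assms] by (intro card_image_le) simp
  moreover have "card (shifted_grid K) \<le> card ({..<K} \<times> {..<K})"
    unfolding shifted_grid_eq[OF assms] by (intro card_image_le) simp
  ultimately show "card (shifted_grid K) = K\<^sup>2" using c by (simp add: power2_eq_square)
  have unit: "0 \<le> (real k + 1 / 2) / K \<and> (real k + 1 / 2) / K \<le> 1" if "k < K" for k
    using that by (auto simp: field_simps)
  have shift: "(real i + 1 / 2) / K = 1 / (2 * real K) + real i / K" for i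
    using assms by (simp add: field_simps)
  have ind: "indicator (spherical_cap w t) (lambert (x, y)) = (of_bool (t \<le> w \<bullet> lambert (x, y)) :: real)"
    if "0 \<le> y" "y \<le> 1" for x y
    using norm_lambert[OF that] by (simp add: spherical_cap_def indicator_def)
  have "(\<Sum>p\<in>lambert ` shifted_grid K. indicator (spherical_cap w t) p) =
      (\<Sum>(i, j)\<in>{..<K} \<times> {..<K}.
        indicator (spherical_cap w t) (lambert ((real i + 1 / 2) / K, (real j + 1 / 2) / K)))"
    unfolding im by (subst sum.reindex[OF inj_on_grid[OF assms]]) (simp add: case_prod_unfold)
  also have "\<dots> = (\<Sum>j<K. \<Sum>i<K.
        indicator (spherical_cap w t) (lambert ((real i + 1 / 2) / K, (real j + 1 / 2) / K)))"
    by (subst sum.cartesian_product[symmetric]) (rule sum.swap)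
  also have "\<dots> = (\<Sum>j<K. row_count K w t (1 / (2 * real K)) ((real j + 1 / 2) / K))"
    unfolding row_count_def using unit
    by (intro sum.cong refl, subst ind) (simp_all only: lessThan_iff shift)
  finally show "(\<Sum>p\<in>lambert ` shifted_grid K. indicator (spherical_cap w t) p) =
      (\<Sum>j<K. row_count K w t (1 / (2 * real K)) ((real j + 1 / 2) / K))" .
qed

section \<open>The two discrepancy bounds\<close>

lemma cap_count_error:
  assumes K: "K \<ge> 1"
  shows "\<bar>(\<Sum>p\<in>lambert ` shifted_grid K. indicator (spherical_cap w t) p)
     - (real K)\<^sup>2 * measure sphere_measure (spherical_cap w t)\<bar> \<le> 3 * real K"
proof -
  define x where "x = 1 / (2 * real K)"
  define m where "m j = row_count K w t x ((real j + 1 / 2) / K)" for j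
  define e where "e j = (\<Sum>i<K. of_bool (straddles K w t (x + real i / real K) j) :: real)" for j
  define \<mu> where "\<mu> j = (real K)\<^sup>2 * measure sphere_measure (spherical_cap w t \<inter> band K j)" for j
  have err: "\<bar>m j - \<mu> j\<bar> \<le> 1 + e j" if j: "j < K" for j
  proof -
    have c: "(real j + 1 / 2) / K \<in> band_interval K j"
      using j by (auto simp: band_interval_def field_simps)
    \<comment> \<open>From any point of the band, move along its parallel to a meridian through the
      grid row, which costs at most 1, and then along the \<open>K\<close> meridians to the row,
      which costs at most \<open>e j\<close>.\<close>
    have "m j - (1 + e j) \<le> row_count K w t x' y \<and> row_count K w t x' y \<le> m j + (1 + e j)"
      if y: "y \<in> band_interval K j" for x' y
    proof -
      have "\<bar>row_count K w t x' y - row_count K w t x y\<bar> \<le> 1"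
        using row_count_shift[OF K] band_interval_unit[OF y j] by blast
      moreover have "\<bar>row_count K w t x y - m j\<bar> \<le> e j"
        unfolding m_def e_def by (rule row_count_band[OF y c])
      ultimately show ?thesis by linarith
    qed
    from measure_cap_Int_band_bounds[OF j this] show ?thesis
      unfolding \<mu>_def by (simp add: abs_le_iff)
  qed
  \<comment> \<open>Exchanging the sums counts, for each of the \<open>K\<close> meridians, the
    bands it straddles.\<close>
  have "(\<Sum>j<K. e j) = (\<Sum>i<K. \<Sum>j<K. of_bool (straddles K w t (x + real i / real K) j))"
    unfolding e_def by (rule sum.swap)
  also have "\<dots> \<le> (\<Sum>i<K. 2)" by (intro sum_mono sum_straddles_le_2)
  finally have e: "(\<Sum>j<K. e j) \<le> 2 * K" by simp
  have "\<bar>(\<Sum>j<K. m j) - (\<Sum>j<K. \<mu> j)\<bar> \<le> (\<Sum>j<K. \<bar>m j - \<mu> j\<bar>)"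
    unfolding sum_subtractf[symmetric] by (rule sum_abs)
  also have "\<dots> \<le> (\<Sum>j<K. 1 + e j)" using err by (intro sum_mono) simp
  also have "\<dots> \<le> 3 * K" using e by (simp add: sum.distrib)
  finally have "\<bar>(\<Sum>j<K. m j) - (\<Sum>j<K. \<mu> j)\<bar> \<le> 3 * K" .
  then show ?thesis
    by (simp only: sum_lambert_shifted_grid[OF K] measure_cap_eq_sum_bands[OF K, of w t]
      sum_distrib_left m_def \<mu>_def x_def)
qed

text \<open>The threshold puts the boundary of the cap at \<open>y = 1 / (2 * K)\<close>, the
  parallel of the first row. The cap is closed, so it contains this row, while all other rows lie
  outside.\<close>

lemma sum_first_row:
  assumes K: "K \<ge> 1"
  shows "(\<Sum>p\<in>lambert ` shifted_grid K. indicator (spherical_cap (axis 3 1) (1 - 1 / K)) p) = real K"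
proof -
  have "row_count K (axis 3 1) (1 - 1 / K) x ((real j + 1 / 2) / K) = (if j = 0 then real K else 0)" for x j
  proof -
    have "1 - 1 / K \<le> axis 3 1 \<bullet> lambert (u, (real j + 1 / 2) / K) \<longleftrightarrow> j = 0" for u
    proof -
      have "2 * ((real j + 1 / 2) / K) = 2 * real j / K + 1 / K"
        by (simp add: add_divide_distrib)
      then show ?thesis using K by (simp add: inner_axis_3 divide_le_0_iff)
    qed
    then show ?thesis by (simp add: row_count_def)
  qed
  then show ?thesis using K by (simp add: sum_lambert_shifted_grid)
qed

theorem mainTheorem3:
  fixes K N :: nat
  assumes "K \<ge> 1"
  assumes "N = card (shifted_grid K)"
  shows "N = K\<^sup>2 \<and>
         1 / 2 \<le> sqrt (real N) * cap_discrepancy (lambert ` shifted_grid K) \<and>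
         sqrt (real N) * cap_discrepancy (lambert ` shifted_grid K) \<le> sqrt 18"
proof -
  note K = assms(1)
  have Kp: "real K > 0" using K by simp
  have N: "N = K\<^sup>2" using assms card_shifted_grid by simp
  define P where "P = lambert ` shifted_grid K"
  define D where "D w t = \<bar>(\<Sum>p\<in>P. indicator (spherical_cap w t) p) / real (card P)
          - measure sphere_measure (spherical_cap w t)\<bar>" for w t
  have card_P: "real (card P) = (real K)\<^sup>2"
    by (simp add: P_def card_lambert_shifted_grid[OF K])
  have D_le: "D w t \<le> 3 / K" for w t
  proof -
    have "D w t = \<bar>(\<Sum>p\<in>P. indicator (spherical_cap w t) p)
      - (real K)\<^sup>2 * measure sphere_measure (spherical_cap w t)\<bar> / (real K)\<^sup>2"
    proof -
      have "s / (real K)\<^sup>2 - \<mu> = (s - (real K)\<^sup>2 * \<mu>) / (real K)\<^sup>2" for s \<mu>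
        using Kp by (simp add: diff_divide_distrib)
      then show ?thesis unfolding D_def card_P by simp
    qed
    also have "\<dots> \<le> 3 * real K / (real K)\<^sup>2"
      unfolding P_def by (intro divide_right_mono cap_count_error[OF K]) simp
    finally show ?thesis using Kp by (simp add: power2_eq_square)
  qed
  have disc: "cap_discrepancy P = (SUP w\<in>sphere 0 1. SUP t\<in>{-1..1}. D w t)"
    by (simp add: cap_discrepancy_def D_def)
  have axis: "axis 3 1 \<in> (sphere 0 1 :: (real^3) set)" by (simp add: norm_axis_1)
  have SUP_le: "(SUP t\<in>{-1..1}. D w t) \<le> 3 / K" for w
    using D_le by (intro cSUP_least) auto
  have "cap_discrepancy P \<le> 3 / K"
    unfolding disc by (rule cSUP_least) (use SUP_le axis in auto)
  then have "K * cap_discrepancy P \<le> 3"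
    using Kp by (simp add: field_simps)
  moreover have "3 \<le> sqrt (18::real)" by (rule real_le_rsqrt) simp
  ultimately have upper: "K * cap_discrepancy P \<le> sqrt 18" by linarith
  \<comment> \<open>The witness for the lower bound: this cap holds the share \<open>1 / K\<close>
    of the points, but has only half of that as its measure.\<close>
  have t: "1 - 1 / real K \<in> {-1..1}" using K by (simp add: field_simps)
  have count: "(\<Sum>p\<in>P. indicator (spherical_cap (axis 3 1) (1 - 1 / K)) p) = real K"
    unfolding P_def by (rule sum_first_row[OF K])
  have meas: "measure sphere_measure (spherical_cap (axis 3 1) (1 - 1 / K)) = 1 / (2 * K)"
    using t by (simp add: measure_polar_cap)
  have "real K / (real K)\<^sup>2 - 1 / (2 * K) = 1 / (2 * K)"
    using Kp by (simp add: power2_eq_square field_simps)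
  then have "D (axis 3 1) (1 - 1 / K) = 1 / (2 * K)"
    unfolding D_def card_P count meas by simp
  then have "1 / (2 * K) = D (axis 3 1) (1 - 1 / K)" ..
  \<comment> \<open>A real supremum bounds its family only if the family is bounded above;
    \<open>D_le\<close> provides this.\<close>
  also have "\<dots> \<le> (SUP t\<in>{-1..1}. D (axis 3 1) t)"
    using t D_le by (intro cSUP_upper bdd_aboveI2) auto
  also have "\<dots> \<le> cap_discrepancy P"
    unfolding disc by (rule cSUP_upper[OF axis]) (use SUP_le in \<open>auto intro!: bdd_aboveI2\<close>)
  finally have "1 / 2 \<le> K * cap_discrepancy P"
    using Kp by (simp add: field_simps)
  with upper show ?thesis by (simp add: N P_def)
qed

end
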